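(* Let $\lambda\in\mathbb{C}$ be a totally real algebraic integer of degree $d>1$. If $\lambda$ is representable, then $$E_s(n,\lambda)\geq n/d-o(n)\qquad\text{as } n\to\infty.$$
   Context: $E_s(n,\lambda)$ is the maximum, over all $n$-vertex graphs (simple and undirected), of the multiplicity of $\lambda$ as an eigenvalue of the adjacency matrix (multiplicity $0$ if $\lambda$ is not an eigenvalue). An algebraic integer is totally real if all its Galois conjugates over $\mathbb{Q}$ are real. A totally real algebraic integer $\lambda$ is called representable if there exists a symmetric matrix $M$ with integer entries such that the map $\lambda\mapsto M$ is an isomorphism of the algebras $\mathbb{Z}[\lambda]$ and $\mathbb{Z}[M]$; in other words, the only eigenvalues of $M$ are $\lambda$ and its conjugates. *)

theory Defs
  imports
    "Jordan_Normal_Form.Char_Poly"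
    "Graph_Theory.Pair_Digraph"
    "HOL-Algebra.Generated_Rings"
    "HOL-Algebra.Algebraic_Closure_Type"
    "HOL-Library.Landau_Symbols"
begin

definition adjacency_matrix :: "nat \<Rightarrow> nat pair_pre_digraph \<Rightarrow> complex mat" where
  "adjacency_matrix n G = mat n n (\<lambda>(i, j). of_bool ((i, j) \<in> parcs G))"

text \<open>This is the algebraic multiplicity. It is only applied to real symmetric matrices, for
  which it agrees with the geometric one.\<close>

definition eigenvalue_multiplicity :: "complex \<Rightarrow> complex mat \<Rightarrow> nat" where
  "eigenvalue_multiplicity \<theta> A = Polynomial.order \<theta> (char_poly A)"

text \<open>A loop-free symmetric digraph without parallel arcs is the same thing as a simple
  undirected graph. Every graph on \<open>n\<close> vertices is isomorphic to one with vertex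
  set \<open>{..<n}\<close>.\<close>

definition simple_graphs :: "nat \<Rightarrow> nat pair_pre_digraph set" where
  "simple_graphs n = {G. pair_graph G \<and> pverts G = {..<n}}"

definition E_s :: "nat \<Rightarrow> complex \<Rightarrow> nat" where
  "E_s n \<theta> = Max ((\<lambda>G. eigenvalue_multiplicity \<theta> (adjacency_matrix n G)) ` simple_graphs n)"

lemma finite_simple_graphs: "finite (simple_graphs n)"
proof (rule finite_subset)
  show "simple_graphs n \<subseteq>
      (\<lambda>E. \<lparr>pverts = {..<n}, parcs = E\<rparr>) ` Pow ({..<n} \<times> {..<n})"
  proof
    fix G assume "G \<in> simple_graphs n"
    then interpret pair_graph G by (simp add: simple_graphs_def)
    have "pverts G = {..<n}" using \<open>G \<in> simple_graphs n\<close> by (simp add: simple_graphs_def)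
    moreover have "parcs G \<subseteq> pverts G \<times> pverts G"
      using in_arcsD1 in_arcsD2 by auto
    ultimately show "G \<in> (\<lambda>E. \<lparr>pverts = {..<n}, parcs = E\<rparr>) ` Pow ({..<n} \<times> {..<n})"
      by (intro image_eqI[where x = "parcs G"]) auto
  qed
qed simp

lemma simple_graphs_nonempty: "simple_graphs n \<noteq> {}"
proof -
  have "\<lparr>pverts = {..<n}, parcs = {}\<rparr> \<in> simple_graphs n"
    by (auto simp: simple_graphs_def intro!: pair_graph.intro pair_digraph.intro
        pair_pseudo_graph.intro pair_fin_digraph.intro pair_sym_digraph.intro
        pair_loopfree_digraph.intro pair_wf_digraph.intro pair_fin_digraph_axioms.intro
        pair_sym_digraph_axioms.intro pair_loopfree_digraph_axioms.intro
        simp: symmetric_def)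
  thus ?thesis by blast
qed

definition is_minimal_polynomial :: "rat poly \<Rightarrow> complex \<Rightarrow> bool" where
  "is_minimal_polynomial p \<theta> \<longleftrightarrow>
     Polynomial.lead_coeff p = 1 \<and> Factorial_Ring.irreducible p \<and> poly (map_poly of_rat p) \<theta> = 0"

definition minimal_polynomial :: "complex \<Rightarrow> rat poly" where
  "minimal_polynomial \<theta> = (THE p. is_minimal_polynomial p \<theta>)"

lemma ex1_minimal_polynomial:
  assumes "algebraic \<theta>"
  shows "\<exists>!p. is_minimal_polynomial p \<theta>"
proof (rule ex_ex1I)
  interpret ev_hom: map_poly_comm_ring_hom "of_rat :: rat \<Rightarrow> complex" ..
  let ?ev = "\<lambda>p :: rat poly. poly (map_poly of_rat p) \<theta>"
  have ev_add: "?ev (p + q) = ?ev p + ?ev q" and ev_mult: "?ev (p * q) = ?ev p * ?ev q"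
    and ev_one: "?ev 1 = 1" for p q
    by (simp_all add: ev_hom.hom_add ev_hom.hom_mult ev_hom.hom_one)
  have ev_smult: "?ev (Polynomial.smult c p) = of_rat c * ?ev p" for c p
    by (simp add: hom_distribs)
  show "\<exists>p. is_minimal_polynomial p \<theta>"
  proof -
    obtain r :: "complex poly" where r: "\<And>i. Polynomial.coeff r i \<in> \<rat>" "r \<noteq> 0" "poly r \<theta> = 0"
      using assms by (auto simp: algebraic_altdef)
    define f :: "complex \<Rightarrow> rat" where "f = inv_into UNIV of_rat"
    define q where "q = map_poly f r"
    have f_of_rat: "f (of_rat x) = x" for x
      by (simp add: f_def inj_on_def)
    hence "f 0 = 0" by (metis of_rat_0)
    moreover have "of_rat (f (Polynomial.coeff r i)) = Polynomial.coeff r i" for i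
      using r(1)[of i] f_of_rat by (auto elim: Rats_cases)
    ultimately have "map_poly of_rat q = r"
      by (intro poly_eqI) (simp add: q_def coeff_map_poly)
    hence q: "q \<noteq> 0" "?ev q = 0" using r by auto
    have "\<exists>p. Factorial_Ring.irreducible p \<and> ?ev p = 0" if "q \<noteq> 0" "?ev q = 0" for q
      using that
    proof (induction q rule: prime_divisors_induct)
      case zero thus ?case by simp
    next
      case (unit x)
      then obtain y where "x * y = 1" by (metis dvdE)
      hence "?ev x * ?ev y = 1" by (metis ev_mult ev_one)
      thus ?case using unit by simp
    next
      case (factor p x)
      thus ?case by (auto simp: ev_mult prime_elem_imp_irreducible prime_def)
    qed
    then obtain p where p: "Factorial_Ring.irreducible p" "?ev p = 0" using q by blast
    hence "p \<noteq> 0" by auto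
    hence "is_minimal_polynomial (Polynomial.smult (inverse (Polynomial.lead_coeff p)) p) \<theta>"
      using p by (auto simp: is_minimal_polynomial_def ev_smult irreducible_smult_field)
    thus ?thesis by blast
  qed
  fix p q assume pq: "is_minimal_polynomial p \<theta>" "is_minimal_polynomial q \<theta>"
  have "\<not> coprime p q"
  proof
    assume "coprime p q"
    then obtain a b where "a * p + b * q = 1"
      by (metis bezout_coefficients_fst_snd coprime_iff_gcd_eq_1)
    hence "?ev (a * p + b * q) = 1" using ev_one by simp
    thus False using pq by (simp add: ev_add ev_mult is_minimal_polynomial_def)
  qed
  hence "\<not> coprime q p" by (simp add: coprime_commute)
  have "prime_elem p" "prime_elem q"
    using pq by (auto simp: is_minimal_polynomial_def intro: irreducible_imp_prime_elem)
  hence "p dvd q" "q dvd p"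
    using \<open>\<not> coprime p q\<close> \<open>\<not> coprime q p\<close> prime_elem_imp_coprime by blast+
  thus "p = q"
    using pq by (intro poly_dvd_antisym) (auto simp: is_minimal_polynomial_def)
qed

definition algebraic_degree :: "complex \<Rightarrow> nat" where
  "algebraic_degree \<theta> = Polynomial.degree (minimal_polynomial \<theta>)"

definition galois_conjugates :: "complex \<Rightarrow> complex set" where
  "galois_conjugates \<theta> = {\<mu>. poly (map_poly of_rat (minimal_polynomial \<theta>)) \<mu> = 0}"

definition totally_real_algebraic_int :: "complex \<Rightarrow> bool" where
  "totally_real_algebraic_int \<theta> \<longleftrightarrow> algebraic_int \<theta> \<and> galois_conjugates \<theta> \<subseteq> \<real>"

text \<open>The ring \<open>\<int>[x]\<close>, as a subring of \<open>R\<close>. Ring isomorphisms between such rings are the same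
  as \<open>\<int>\<close>-algebra isomorphisms.\<close>

definition generated_subring :: "('a, 'b) ring_scheme \<Rightarrow> 'a \<Rightarrow> ('a, 'b) ring_scheme" where
  "generated_subring R x = R\<lparr>carrier := generate_ring R {x}\<rparr>"

text \<open>The case \<open>m = 0\<close> needs no exclusion: there \<open>\<int>[M]\<close> is the zero ring.\<close>

definition representable :: "complex \<Rightarrow> bool" where
  "representable \<theta> \<longleftrightarrow>
     (\<exists>m. \<exists>M \<in> carrier_mat m m. \<exists>h.
        transpose_mat M = (M :: int mat) \<and>
        h \<in> ring_iso (generated_subring (ring_of_type_algebra :: complex ring) \<theta>)
                     (generated_subring (ring_mat TYPE(int) m ()) M) \<and>
        h \<theta> = M)"

end

theory Submission
  imports
    Defs
    "HOL-Real_Asymp.Real_Asymp"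
begin

text \<open>Let \<open>M\<close> be an \<open>m \<times> m\<close> matrix representing \<open>\<theta>\<close>. Its characteristic polynomial \<open>\<chi>\<close> is a power of
  the minimal polynomial of \<open>\<theta>\<close>, so \<open>\<theta>\<close> is a root of order \<open>m / d\<close>. For every integer \<open>a\<close> there is a
  graph on \<open>N\<close> points whose adjacency matrix is \<open>a I\<close> up to rank \<open>O(sqrt N)\<close>: place the points in a
  square grid; for \<open>a < 0\<close> join distinct points lying on a common line with one of \<open>-a\<close> slopes, and
  for \<open>a \<ge> 0\<close> take the complement of the graph for \<open>-(a + 1)\<close>. Using these as the blocks of an
  \<open>m \<times> m\<close> block matrix according to the entries of \<open>M\<close> gives a graph with adjacency matrix
  \<open>I \<otimes> M\<close> up to rank \<open>r = O(sqrt N)\<close>, and \<open>\<chi>\<^sup>N\<close> divides its characteristic polynomial times \<open>\<chi>\<^sup>r\<close>.\<close>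

subsection \<open>Low-rank perturbations of block diagonal matrices\<close>

text \<open>The Kronecker product of the identity of size \<open>N\<close> with \<open>B\<close>: an
  index encodes the pair of its block \<open>i div m\<close> and its place \<open>i mod m\<close>
  inside that block.\<close>

definition block_diagonal :: "nat \<Rightarrow> nat \<Rightarrow> 'a :: zero mat \<Rightarrow> 'a mat" where
  "block_diagonal N m B = mat (N * m) (N * m)
     (\<lambda>(i, j). if i div m = j div m then B $$ (i mod m, j mod m) else 0)"

lemma block_diagonal_carrier [simp]: "block_diagonal N m B \<in> carrier_mat (N * m) (N * m)"
  by (simp add: block_diagonal_def)

text \<open>The sum over the middle index is cut into blocks of length \<open>m\<close>, of which
  only the one numbered \<open>i div m = j div m\<close> can contribute.\<close>

lemma block_diagonal_mult:
  fixes B C :: "'a :: semiring_0 mat"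
  assumes "B \<in> carrier_mat m m" "C \<in> carrier_mat m m"
  shows "block_diagonal N m B * block_diagonal N m C = block_diagonal N m (B * C)"
proof (rule eq_matI)
  fix i j assume "i < dim_row (block_diagonal N m (B * C))" "j < dim_col (block_diagonal N m (B * C))"
  hence ij: "i < N * m" "j < N * m" by (auto simp: block_diagonal_def)
  hence m: "m > 0" by (cases m) auto
  define g where "g = (\<lambda>k. (if i div m = k div m then B $$ (i mod m, k mod m) else 0) *
      (if k div m = j div m then C $$ (k mod m, j mod m) else 0))"
  have g: "(\<Sum>k = b * m..<b * m + m. g k) = (if i div m = b \<and> b = j div m
      then (\<Sum>k<m. B $$ (i mod m, k) * C $$ (k, j mod m)) else 0)" for b
  proof -
    have "(\<Sum>k = b * m..<b * m + m. g k) = (\<Sum>k = 0..<m. g (k + b * m))"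
      using sum.shift_bounds_nat_ivl[of g 0 "b * m" m] by (simp add: add.commute)
    also have "\<dots> = (\<Sum>k = 0..<m. if i div m = b \<and> b = j div m
        then B $$ (i mod m, k) * C $$ (k, j mod m) else 0)"
      by (intro sum.cong) (auto simp: g_def)
    finally show ?thesis by (auto simp: atLeast0LessThan)
  qed
  have "(block_diagonal N m B * block_diagonal N m C) $$ (i, j) = (\<Sum>k<N * m. g k)"
    using ij by (simp add: block_diagonal_def scalar_prod_def g_def atLeast0LessThan)
  also have "\<dots> = (\<Sum>b<N. \<Sum>k = b * m..<b * m + m. g k)"
    by (rule sum.nat_group[symmetric])
  also have "\<dots> = (\<Sum>b<N. if b = i div m then (if i div m = j div m
      then (\<Sum>k<m. B $$ (i mod m, k) * C $$ (k, j mod m)) else 0) else 0)"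
    by (intro sum.cong) (auto simp: g)
  also have "\<dots> = (if i div m = j div m
      then (\<Sum>k<m. B $$ (i mod m, k) * C $$ (k, j mod m)) else 0)"
    using ij by (simp add: less_mult_imp_div_less)
  also have "\<dots> = block_diagonal N m (B * C) $$ (i, j)"
    using ij m assms by (auto simp: block_diagonal_def scalar_prod_def atLeast0LessThan)
  finally show "(block_diagonal N m B * block_diagonal N m C) $$ (i, j) =
      block_diagonal N m (B * C) $$ (i, j)" .
qed (auto simp: block_diagonal_def)

lemma block_diagonal_scalar:
  "block_diagonal N m (c \<cdot>\<^sub>m 1\<^sub>m m) = (c :: 'a :: semiring_1) \<cdot>\<^sub>m 1\<^sub>m (N * m)"
proof (rule eq_matI)
  fix i j assume "i < dim_row (c \<cdot>\<^sub>m 1\<^sub>m (N * m))" "j < dim_col (c \<cdot>\<^sub>m 1\<^sub>m (N * m))"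
  hence ij: "i < N * m" "j < N * m" by auto
  hence m: "m > 0" by (cases m) auto
  have "i = j" if "i div m = j div m" "i mod m = j mod m"
    using that by (metis div_mult_mod_eq)
  thus "block_diagonal N m (c \<cdot>\<^sub>m 1\<^sub>m m) $$ (i, j) = (c \<cdot>\<^sub>m 1\<^sub>m (N * m)) $$ (i, j)"
    using ij m by (auto simp: block_diagonal_def)
qed (auto simp: block_diagonal_def)

lemma det_block_diagonal:
  fixes B :: "'a :: idom mat"
  assumes "B \<in> carrier_mat m m"
  shows "det (block_diagonal N m B) = det B ^ N"
proof (induction N)
  case 0
  show ?case using block_diagonal_carrier[of 0 m B] by simp
next
  case (Suc N)
  have "block_diagonal (Suc N) m B = four_block_mat B (0\<^sub>m m (N * m)) (0\<^sub>m (N * m) m) (block_diagonal N m B)"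
  proof (cases "m = 0")
    case False
    thus ?thesis
      by (intro eq_matI)
        (use assms in \<open>auto simp: block_diagonal_def not_less div_eq_0_iff le_div_geq le_mod_geq\<close>)
  qed (use assms in \<open>auto simp: mat_eq_iff block_diagonal_def\<close>)
  thus ?case
    using det_four_block_mat_upper_right_zero[OF assms refl zero_carrier_mat block_diagonal_carrier] Suc
    by simp
qed

lemma smult_one_mult_mat [simp]:
  "A \<in> carrier_mat n k \<Longrightarrow> (c \<cdot>\<^sub>m 1\<^sub>m n) * A = (c :: 'a :: comm_semiring_1) \<cdot>\<^sub>m A"
  by (subst mult_smult_assoc_mat[of _ n n _ k]) auto

text \<open>Both sides come from multiplying the block matrix with rows \<open>Y, L\<close> and \<open>R, 1\<close> by a block
  triangular matrix, from the right and from the left.\<close>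

lemma det_low_rank_update:
  fixes Y Z L R :: "'a :: idom mat"
  assumes Y: "Y \<in> carrier_mat n n" and Z: "Z \<in> carrier_mat n n"
    and L: "L \<in> carrier_mat n r" and R: "R \<in> carrier_mat r n"
    and ZY: "Z * Y = c \<cdot>\<^sub>m 1\<^sub>m n"
  shows "det Z * c ^ r * det (Y - L * R) = c ^ n * det (c \<cdot>\<^sub>m 1\<^sub>m r - R * Z * L)"
proof -
  define K where "K = four_block_mat Y L R (1\<^sub>m r)"
  define U where "U = four_block_mat (1\<^sub>m n) (0\<^sub>m n r) (- R) (1\<^sub>m r)"
  define V where "V = four_block_mat Z (0\<^sub>m n r) (- (R * Z)) (c \<cdot>\<^sub>m 1\<^sub>m r)"
  have [simp]: "K \<in> carrier_mat (n + r) (n + r)" "U \<in> carrier_mat (n + r) (n + r)"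
    "V \<in> carrier_mat (n + r) (n + r)"
    using Y Z R L by (auto simp: K_def U_def V_def)
  have "K * U = four_block_mat (Y * 1\<^sub>m n + L * - R) (Y * 0\<^sub>m n r + L * 1\<^sub>m r)
      (R * 1\<^sub>m n + 1\<^sub>m r * - R) (R * 0\<^sub>m n r + 1\<^sub>m r * 1\<^sub>m r)"
    unfolding K_def U_def by (rule mult_four_block_mat) (use Y L R in auto)
  also have "Y * 1\<^sub>m n + L * - R = Y - L * R"
    using Y L R by (auto simp: uminus_mult_right_mat minus_add_uminus_mat[of _ n n])
  also have "R * 1\<^sub>m n + 1\<^sub>m r * - R = 0\<^sub>m r n"
    using R by (auto simp: mat_eq_iff)
  also have "Y * 0\<^sub>m n r + L * 1\<^sub>m r = L" using Y L by auto
  also have "R * 0\<^sub>m n r + 1\<^sub>m r * 1\<^sub>m r = 1\<^sub>m r" using R by auto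
  finally have "det (K * U) = det (Y - L * R)"
    using det_four_block_mat_lower_left_zero[of "Y - L * R" n L r "0\<^sub>m r n" "1\<^sub>m r"] L
      minus_carrier_mat[OF mult_carrier_mat[OF L R], of Y] by simp
  moreover have "det U = 1"
    unfolding U_def using R by (subst det_four_block_mat_upper_right_zero[of _ n _ r]) auto
  ultimately have 1: "det K = det (Y - L * R)"
    by (simp add: det_mult[of K "n + r"])
  have "V * K = four_block_mat (Z * Y + 0\<^sub>m n r * R) (Z * L + 0\<^sub>m n r * 1\<^sub>m r)
      (- (R * Z) * Y + (c \<cdot>\<^sub>m 1\<^sub>m r) * R) (- (R * Z) * L + (c \<cdot>\<^sub>m 1\<^sub>m r) * 1\<^sub>m r)"
    unfolding K_def V_def by (rule mult_four_block_mat) (use Y Z L R in auto)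
  also have "- (R * Z) * Y + (c \<cdot>\<^sub>m 1\<^sub>m r) * R = 0\<^sub>m r n"
  proof -
    have "- (R * Z) * Y = - (R * (Z * Y))"
      using R Z Y by (simp add: assoc_mult_mat[of R r n Z n Y n])
    also have "R * (Z * Y) = c \<cdot>\<^sub>m R"
      unfolding ZY using R by (simp add: mult_smult_distrib[of R r n "1\<^sub>m n" n])
    finally show ?thesis using R by (auto simp: mat_eq_iff)
  qed
  also have "- (R * Z) * L + (c \<cdot>\<^sub>m 1\<^sub>m r) * 1\<^sub>m r = c \<cdot>\<^sub>m 1\<^sub>m r - R * Z * L"
    using R Z L by (auto simp: minus_add_uminus_mat[of _ r r] comm_add_mat[of _ r r])
  also have "Z * Y + 0\<^sub>m n r * R = c \<cdot>\<^sub>m 1\<^sub>m n" using R ZY by auto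
  finally have "det (V * K) = c ^ n * det (c \<cdot>\<^sub>m 1\<^sub>m r - R * Z * L)"
    using det_four_block_mat_lower_left_zero[of "c \<cdot>\<^sub>m 1\<^sub>m n" n "Z * L + 0\<^sub>m n r * 1\<^sub>m r" r "0\<^sub>m r n"
        "c \<cdot>\<^sub>m 1\<^sub>m r - R * Z * L"] mult_carrier_mat[OF Z L]
      minus_carrier_mat[OF mult_carrier_mat[OF mult_carrier_mat[OF R Z] L], of "c \<cdot>\<^sub>m 1\<^sub>m r"]
    by (simp add: det_smult)
  moreover have "det V = det Z * c ^ r"
    unfolding V_def using Z R by (subst det_four_block_mat_upper_right_zero[of _ n _ r]) (auto simp: det_smult)
  ultimately show ?thesis
    by (simp add: det_mult[of V "n + r"] 1)
qed

text \<open>In place of an inverse of \<open>X - M\<close> its adjugate is used, which inverts it up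
  to the factor \<open>char_poly M\<close>; the same holds blockwise. The perturbation is a sum of
  \<open>card E\<close> rank-one matrices, so it factors as \<open>L * R\<close> with inner
  dimension \<open>card E\<close>, and \<open>det_low_rank_update\<close> applies.\<close>

lemma char_poly_low_rank_update:
  fixes A M :: "'a :: field mat" and u v :: "'e \<Rightarrow> nat \<Rightarrow> 'a"
  assumes A: "A \<in> carrier_mat (N * m) (N * m)" and M: "M \<in> carrier_mat m m"
    and E: "finite E"
    and eq: "\<And>i j. i < N * m \<Longrightarrow> j < N * m \<Longrightarrow> A $$ (i, j) =
      (if i div m = j div m then M $$ (i mod m, j mod m) else 0) + (\<Sum>e\<in>E. u e i * v e j)"
  shows "char_poly M ^ N dvd char_poly A * char_poly M ^ card E"
proof -
  define n r c where "n = N * m" and "r = card E" and "c = char_poly M"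
  obtain b where b: "bij_betw b {0..<r} E"
    using E ex_bij_betw_nat_finite r_def by blast
  define B where "B = char_poly_matrix M"
  have B: "B \<in> carrier_mat m m" using M by (simp add: B_def)
  have detB: "det B = c" by (simp add: B_def c_def char_poly_def)
  define Y Z where "Y = block_diagonal N m B" and "Z = block_diagonal N m (adj_mat B)"
  define L where "L = mat n r (\<lambda>(i, e). [:u (b e) i:])"
  define R where "R = mat r n (\<lambda>(e, j). [:v (b e) j:])"
  have car: "Y \<in> carrier_mat n n" "Z \<in> carrier_mat n n" "L \<in> carrier_mat n r" "R \<in> carrier_mat r n"
    by (simp_all add: Y_def Z_def n_def L_def R_def)
  have "char_poly_matrix A = Y - L * R"
  proof (rule eq_matI)
    fix i j assume "i < dim_row (Y - L * R)" "j < dim_col (Y - L * R)"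
    hence ij: "i < n" "j < n" using car by auto
    hence m: "m > 0" unfolding n_def by (cases m) auto
    have ij_eq: "i = j \<longleftrightarrow> i div m = j div m \<and> i mod m = j mod m"
      by (metis div_mult_mod_eq)
    have "(L * R) $$ (i, j) = (\<Sum>e = 0..<r. [:u (b e) i * v (b e) j:])"
      using ij by (simp add: L_def R_def scalar_prod_def mult.commute)
    also have "\<dots> = (\<Sum>e\<in>E. [:u e i * v e j:])"
      by (rule sum.reindex_bij_betw[OF b])
    also have "\<dots> = [:\<Sum>e\<in>E. u e i * v e j:]"
      using E by (induction rule: finite_induct) auto
    finally have "(L * R) $$ (i, j) = [:\<Sum>e\<in>E. u e i * v e j:]" .
    thus "char_poly_matrix A $$ (i, j) = (Y - L * R) $$ (i, j)"
      using ij ij_eq m A M car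
      by (auto simp: n_def char_poly_matrix_def Y_def B_def block_diagonal_def eq)
  qed (use A car in \<open>auto simp: n_def char_poly_matrix_def\<close>)
  hence A_eq: "char_poly A = det (Y - L * R)" by (simp add: char_poly_def)
  have ZY: "Z * Y = c \<cdot>\<^sub>m 1\<^sub>m n"
    using adj_mat[OF B] B unfolding Z_def Y_def n_def
    by (simp add: block_diagonal_mult block_diagonal_scalar detB)
  have "c \<noteq> 0" using degree_monic_char_poly[OF M] unfolding c_def by auto
  have detY: "det Y = c ^ N" by (simp add: Y_def det_block_diagonal[OF B] detB)
  have "det Z * det Y = c ^ n"
    unfolding det_mult[OF car(2,1), symmetric] ZY by (simp add: det_smult)
  \<comment> \<open>Multiplying by \<open>det Y\<close> turns \<open>det Z\<close> into
    \<open>c ^ n\<close>, which then stands on both sides and cancels because \<open>c\<close> is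
    nonzero.\<close>
  hence "c ^ n * (c ^ r * char_poly A) = det Y * (det Z * c ^ r * det (Y - L * R))"
    unfolding A_eq by (metis (no_types) mult.assoc mult.commute)
  also have "\<dots> = c ^ n * (c ^ N * det (c \<cdot>\<^sub>m 1\<^sub>m r - R * Z * L))"
    by (simp add: det_low_rank_update[OF car(1-4) ZY] detY)
  finally have "c ^ r * char_poly A = c ^ N * det (c \<cdot>\<^sub>m 1\<^sub>m r - R * Z * L)"
    using \<open>c \<noteq> 0\<close> by simp
  thus ?thesis by (metis c_def r_def dvd_triv_left mult.commute)
qed

subsection \<open>Matrices representing an algebraic number\<close>

text \<open>A ring homomorphism with \<open>\<theta>\<close> mapped to \<open>M\<close> carries the
  relation \<open>q(\<theta>) = 0\<close> over to \<open>q(M) = 0\<close>, and on an eigenvector for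
  \<open>\<mu>\<close> the matrix \<open>q(M)\<close> acts as the scalar
  \<open>q(\<mu>)\<close>.\<close>

lemma ring_iso_annihilates_eigenvalues:
  fixes M :: "int mat"
  assumes M: "M \<in> carrier_mat m m"
    and h: "h \<in> ring_iso (generated_subring (ring_of_type_algebra :: complex ring) \<theta>)
                     (generated_subring (ring_mat TYPE(int) m ()) M)"
    and h\<theta>: "h \<theta> = M"
    and q: "poly (map_poly of_int q) \<theta> = 0"
    and \<mu>: "eigenvalue (map_mat of_int M) (\<mu> :: complex)"
  shows "poly (map_poly of_int q) \<mu> = 0"
proof -
  define R where "R = (ring_of_type_algebra :: complex ring)"
  define C where "C = generate_ring R {\<theta>}"
  interpret R: cring R unfolding R_def by (rule cring_from_type_algebra)
  have R_ops: "x \<oplus>\<^bsub>R\<^esub> y = x + y" "x \<otimes>\<^bsub>R\<^esub> y = x * y" "\<one>\<^bsub>R\<^esub> = 1" "\<zero>\<^bsub>R\<^esub> = 0" "carrier R = UNIV" for x y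
    by (simp_all add: R_def ring_of_type_algebra_def)
  have R_neg: "\<ominus>\<^bsub>R\<^esub> x = - x" for x
    by (rule R.minus_equality) (auto simp: R_ops)
  have C: "1 \<in> C" "\<theta> \<in> C" "x \<in> C \<Longrightarrow> - x \<in> C" "x \<in> C \<Longrightarrow> y \<in> C \<Longrightarrow> x + y \<in> C"
    "x \<in> C \<Longrightarrow> y \<in> C \<Longrightarrow> x * y \<in> C" for x y
    using generate_ring.one[of R "{\<theta>}"] generate_ring.incl[of \<theta> "{\<theta>}" R]
      generate_ring.a_inv[of x R "{\<theta>}"] generate_ring.eng_add[of x R "{\<theta>}" y]
      generate_ring.eng_mult[of x R "{\<theta>}" y]
    unfolding C_def R_ops R_neg by blast+
  have C0: "0 \<in> C" using C(1) C(3)[of 1] C(4)[of 1 "-1"] by simp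
  have hom: "h (x + y) = h x + h y" "h (x * y) = h x * h y" if "x \<in> C" "y \<in> C" for x y
    using h that by (auto simp: ring_iso_def ring_hom_def generated_subring_def C_def
        ring_mat_def R_def ring_of_type_algebra_def)
  have h1: "h 1 = 1\<^sub>m m"
    using h by (auto simp: ring_iso_def ring_hom_def generated_subring_def
        ring_mat_def ring_of_type_algebra_def)
  have gen: "generate_ring (ring_mat TYPE(int) m ()) {M} \<subseteq> carrier_mat m m"
    using ring.generate_ring_incl[OF ring_mat, of "{M}" m "()"] M by (simp add: ring_mat_def)
  have h_car: "h x \<in> carrier_mat m m" if "x \<in> C" for x
  proof -
    have "h x \<in> generate_ring (ring_mat TYPE(int) m ()) {M}"
      using h that by (auto simp: ring_iso_def ring_hom_def generated_subring_def C_def R_def)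
    thus ?thesis using gen by blast
  qed
  have h0: "h 0 = 0\<^sub>m m m"
    using hom(1)[OF C0 C0] h_car[OF C0] by (auto simp: mat_eq_iff)
  obtain v where v: "v \<in> carrier_vec m" "v \<noteq> 0\<^sub>v m" "map_mat of_int M *\<^sub>v v = \<mu> \<cdot>\<^sub>v v"
    using \<mu> M by (auto simp: eigenvalue_def eigenvector_def)
  \<comment> \<open>This relation stands in for evaluating polynomials at \<open>M\<close>: it
    respects sums and products and contains \<open>(a, a)\<close> for integers \<open>a\<close> and
    \<open>(\<theta>, \<mu>)\<close>, hence every pair
    \<open>(q(\<theta>), q(\<mu>))\<close>.\<close>
  define acts where "acts x y \<longleftrightarrow> x \<in> C \<and> map_mat of_int (h x) *\<^sub>v v = y \<cdot>\<^sub>v v" for x and y :: complex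
  have acts_add: "acts (x + x') (y + y')" if "acts x y" "acts x' y'" for x x' y y'
  proof -
    have "map_mat of_int (h (x + x')) *\<^sub>v v =
        (map_mat of_int (h x) + map_mat of_int (h x')) *\<^sub>v v"
      using that h_car[of x] h_car[of x'] unfolding acts_def
      by (intro arg_cong[of _ _ "\<lambda>A. A *\<^sub>v v"] eq_matI) (auto simp: hom)
    also have "\<dots> = y \<cdot>\<^sub>v v + y' \<cdot>\<^sub>v v"
      using that h_car[of x] h_car[of x'] v by (auto simp: acts_def add_mult_distrib_mat_vec[of _ m m])
    finally show ?thesis using that C by (auto simp: acts_def add_smult_distrib_vec)
  qed
  have acts_mult: "acts (x * x') (y * y')" if "acts x y" "acts x' y'" for x x' y y'
  proof -
    have "map_mat of_int (h (x * x')) *\<^sub>v v =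
        map_mat of_int (h x) *\<^sub>v (map_mat of_int (h x') *\<^sub>v v)"
      using that h_car[of x] h_car[of x'] v
      by (auto simp: acts_def hom of_int_hom.mat_hom_mult[of _ m m _ m])
    also have "\<dots> = y' \<cdot>\<^sub>v (y \<cdot>\<^sub>v v)"
      using that h_car[of x] h_car[of x'] v by (auto simp: acts_def mult_mat_vec[of _ m m])
    finally show ?thesis using that C by (auto simp: acts_def smult_smult_assoc mult.commute)
  qed
  have acts_1: "acts 1 1" using v C by (auto simp: acts_def h1 of_int_hom.mat_hom_one)
  have acts_0: "acts 0 0"
  proof -
    have "map_mat of_int (0\<^sub>m m m) = (0\<^sub>m m m :: complex mat)"
      by (rule eq_matI) auto
    thus ?thesis unfolding acts_def h0 using v C0 by auto
  qed
  have acts_neg1: "acts (-1) (-1)"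
  proof -
    have eq: "0\<^sub>m m m = h (-1) + h 1" using hom(1)[of "-1" 1] C by (simp add: h0)
    have "h (-1) = - 1\<^sub>m m"
    proof (rule eq_matI)
      fix i j assume ij: "i < dim_row (- 1\<^sub>m m :: int mat)" "j < dim_col (- 1\<^sub>m m :: int mat)"
      have "0\<^sub>m m m $$ (i, j) = (h (-1) + h 1) $$ (i, j)" by (simp only: eq)
      thus "h (-1) $$ (i, j) = (- 1\<^sub>m m) $$ (i, j)"
        using ij h_car[of "-1"] C by (auto simp: h1 split: if_splits)
    qed (use h_car[of "-1"] C in auto)
    moreover have "map_mat of_int (- 1\<^sub>m m) = (- 1\<^sub>m m :: complex mat)"
      by (rule eq_matI) auto
    ultimately show ?thesis using v C by (auto simp: acts_def)
  qed
  have acts_int: "acts (of_int a) (of_int a)" for a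
  proof (induction a rule: int_induct[where k = 0])
    case base show ?case using acts_0 by simp
  next
    case (step1 i) thus ?case using acts_add[OF _ acts_1] by simp
  next
    case (step2 i) thus ?case using acts_add[OF _ acts_neg1] by simp
  qed
  have acts_\<theta>: "acts \<theta> \<mu>" using v C by (simp add: acts_def h\<theta>)
  have "acts (poly (map_poly of_int q) \<theta>) (poly (map_poly of_int q) \<mu>)" for q
  proof (induction q)
    case 0 show ?case using acts_0 by simp
  next
    case (pCons a q)
    show ?case using acts_add[OF acts_int[of a] acts_mult[OF acts_\<theta> pCons.IH]]
      by (simp add: of_int_hom.map_poly_pCons_hom)
  qed
  from this[of q] have "acts 0 (poly (map_poly of_int q) \<mu>)" by (simp add: q)
  hence "poly (map_poly of_int q) \<mu> \<cdot>\<^sub>v v = 0 \<cdot>\<^sub>v v" using acts_0 by (simp add: acts_def)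
  with v show ?thesis by (auto simp: vec_eq_iff)
qed

text \<open>There is only one \<open>0 \<times> 0\<close> matrix, whereas the ring generated by
  \<open>\<theta>\<close> contains both \<open>0\<close> and \<open>1\<close>, so injectivity of
  \<open>h\<close> would fail.\<close>

lemma ring_iso_imp_dim_pos:
  assumes h: "h \<in> ring_iso (generated_subring (ring_of_type_algebra :: complex ring) \<theta>)
                     (generated_subring (ring_mat TYPE(int) m ()) M)"
    and M: "M \<in> carrier_mat m m"
  shows "m > 0"
proof (rule ccontr)
  assume "\<not> m > 0"
  hence m: "m = 0" by simp
  let ?R = "ring_of_type_algebra :: complex ring"
  have gen: "generate_ring (ring_mat TYPE(int) m ()) {M} \<subseteq> carrier_mat m m"
    using ring.generate_ring_incl[OF ring_mat, of "{M}" m "()"] M by (simp add: ring_mat_def)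
  have "0 \<in> generate_ring ?R {\<theta>}" "1 \<in> generate_ring ?R {\<theta>}"
    using ring.zero_in_generate[OF ring_from_type_algebra, of "{\<theta>}"] generate_ring.one[of ?R "{\<theta>}"]
    by (simp_all add: ring_of_type_algebra_def)
  moreover have "inj_on h (generate_ring ?R {\<theta>})"
    "h ` generate_ring ?R {\<theta>} = generate_ring (ring_mat TYPE(int) m ()) {M}"
    using h by (auto simp: ring_iso_def generated_subring_def bij_betw_def)
  moreover from this have "h x = h y" if "x \<in> generate_ring ?R {\<theta>}" "y \<in> generate_ring ?R {\<theta>}" for x y
  proof -
    have "h x \<in> carrier_mat 0 0" "h y \<in> carrier_mat 0 0"
      using that gen m \<open>h ` _ = _\<close> by blast+
    thus ?thesis by (auto simp: mat_eq_iff)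
  qed
  ultimately show False by (metis inj_onD zero_neq_one)
qed

text \<open>The ring isomorphism transports relations with integer coefficients, while minimal
  polynomials have rational ones. The common denominator is built up coefficient by
  coefficient.\<close>

lemma clear_denominators:
  fixes p :: "rat poly"
  shows "\<exists>q c. c \<noteq> 0 \<and> map_poly of_int q = Polynomial.smult (of_int c) p"
proof (induction p)
  case 0
  show ?case by (intro exI[of _ 0] exI[of _ 1]) simp
next
  case (pCons a p)
  then obtain q c where q: "c \<noteq> 0" "map_poly of_int q = Polynomial.smult (of_int c) p" by blast
  obtain x y where xy: "quotient_of a = (x, y)" by fastforce
  hence "y > 0" "a = of_int x / of_int y"
    using quotient_of_denom_pos quotient_of_div by blast+
  thus ?case
    using q by (intro exI[of _ "pCons (c * x) (Polynomial.smult y q)"] exI[of _ "y * c"])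
      (simp add: map_poly_pCons hom_distribs)
qed

text \<open>Over the rationals the characteristic polynomial is \<open>p ^ k * r\<close> with
  \<open>r\<close> coprime to \<open>p\<close>. A complex root of \<open>r\<close> would be an
  eigenvalue and so a common root of \<open>p\<close> and \<open>r\<close>; hence \<open>r\<close>
  is constant and \<open>m = k * degree p\<close>, and each factor \<open>p\<close> adds at least
  one to the order at \<open>\<theta>\<close>.\<close>

lemma order_char_poly_conjugate_roots:
  fixes M :: "int mat"
  assumes M: "M \<in> carrier_mat m m" and p: "is_minimal_polynomial p \<theta>"
    and roots: "\<And>\<mu> :: complex. eigenvalue (map_mat of_int M) \<mu> \<Longrightarrow> poly (map_poly of_rat p) \<mu> = 0"
  shows "m \<le> Polynomial.order \<theta> (char_poly (map_mat of_int M)) * Polynomial.degree p"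
proof -
  interpret ev: map_poly_comm_ring_hom "of_rat :: rat \<Rightarrow> complex" ..
  let ?ev = "\<lambda>q :: rat poly. map_poly of_rat q :: complex poly"
  have irr: "Factorial_Ring.irreducible p" "prime_elem p" and p0: "p \<noteq> 0" and p\<theta>: "poly (?ev p) \<theta> = 0"
    using p by (auto simp: is_minimal_polynomial_def intro: irreducible_imp_prime_elem)
  define \<chi> where "\<chi> = char_poly (map_mat rat_of_int M)"
  have MQ: "map_mat rat_of_int M \<in> carrier_mat m m" using M by simp
  have \<chi>: "Polynomial.degree \<chi> = m" "\<chi> \<noteq> 0"
    using degree_monic_char_poly[OF MQ] by (auto simp: \<chi>_def)
  have "map_mat complex_of_int M = map_mat of_rat (map_mat rat_of_int M)"
    by (rule eq_matI) auto
  hence \<chi>C: "char_poly (map_mat complex_of_int M) = ?ev \<chi>"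
    using of_rat_hom.char_poly_hom[OF MQ] by (simp add: \<chi>_def)
  obtain k r where r: "\<chi> = p ^ k * r" "\<not> p dvd r"
  proof -
    have "\<not> is_unit p" using irr by (simp add: Factorial_Ring.irreducible_def)
    with \<chi>(2) obtain r where "\<chi> = p ^ multiplicity p \<chi> * r" "\<not> p dvd r"
      by (rule multiplicity_decompose')
    thus thesis by (rule that)
  qed
  have "r \<noteq> 0" using r by auto
  have "Polynomial.degree r = 0"
  proof (rule ccontr)
    assume "Polynomial.degree r \<noteq> 0"
    hence "\<not> constant (poly (?ev r))" by (simp add: constant_degree)
    then obtain \<mu> where \<mu>: "poly (?ev r) \<mu> = 0"
      using fundamental_theorem_of_algebra by blast
    have "poly (?ev \<chi>) \<mu> = 0"
      by (simp add: r(1) ev.hom_mult \<mu>)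
    hence "eigenvalue (map_mat of_int M) \<mu>"
      using M by (subst eigenvalue_root_char_poly[of _ m]) (auto simp: \<chi>C)
    hence p\<mu>: "poly (?ev p) \<mu> = 0" by (rule roots)
    have "coprime p r" using r irr prime_elem_imp_coprime by blast
    \<comment> \<open>A Bezout identity over the rationals excludes common roots in the complex
      numbers as well.\<close>
    then obtain a b where "a * p + b * r = 1"
      by (metis bezout_coefficients_fst_snd coprime_iff_gcd_eq_1)
    hence "poly (?ev (a * p + b * r)) \<mu> = 1" by simp
    thus False using \<mu> p\<mu> by (simp add: ev.hom_mult ev.hom_add)
  qed
  hence "m = k * Polynomial.degree p"
    using \<chi>(1) \<open>r \<noteq> 0\<close> p0 by (simp add: r(1) degree_mult_eq degree_power_eq mult.commute)
  moreover have "k \<le> Polynomial.order \<theta> (?ev \<chi>)"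
  proof -
    have "[:-\<theta>, 1:] ^ k dvd ?ev p ^ k"
      using p\<theta> by (intro dvd_power_same) (simp add: poly_eq_0_iff_dvd)
    also have "?ev p ^ k dvd ?ev \<chi>"
      by (simp add: r(1) ev.hom_mult ev.hom_power)
    finally show ?thesis using \<chi>(2) by (simp add: order_divides)
  qed
  ultimately show ?thesis by (simp add: \<chi>C)
qed

subsection \<open>Graphs from nets\<close>

text \<open>The points are \<open>s = (s mod q, s div q)\<close>, and class \<open>c\<close> is a parallel class of lines with a common
  slope, so that two distinct points share a line in at most one class.\<close>

definition net_class :: "nat \<Rightarrow> nat \<Rightarrow> nat \<Rightarrow> nat" where
  "net_class q c s = s mod q + c * (s div q)"

text \<open>Subtracting the two line equations leaves \<open>(c - c') * (y - y') = 0\<close> for the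
  second coordinates. Lines are compared in the integers rather than modulo \<open>q\<close>, so
  this works for every \<open>q\<close>.\<close>

lemma net_class_inj:
  assumes "net_class q c s = net_class q c t" "net_class q c' s = net_class q c' t" "c \<noteq> c'"
  shows "s = t"
proof -
  have "(int c - int c') * (int (s div q) - int (t div q)) = 0"
    using assms(1,2)[THEN arg_cong[of _ _ int]] by (simp add: net_class_def algebra_simps)
  hence "s div q = t div q" using assms(3) by simp
  moreover from this have "s mod q = t mod q" using assms(1) by (simp add: net_class_def)
  ultimately show "s = t" by (metis div_mult_mod_eq)
qed

text \<open>Both coordinates are below \<open>q\<close>, so the lines of class \<open>c\<close> have
  labels below \<open>(c + 1) * q\<close>. For fixed \<open>T\<close> the number of lines thus grows
  only like the square root of the number of points.\<close>

lemma net_class_less: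
  assumes "s < q * q" "c < T"
  shows "net_class q c s < T * q"
proof -
  have "q > 0" using assms by (cases q) auto
  have "s mod q + c * (s div q) < q + c * q"
    using assms \<open>q > 0\<close>
    by (intro add_less_le_mono mult_left_mono) (auto intro: less_imp_le less_mult_imp_div_less)
  also have "\<dots> = Suc c * q" by simp
  also have "\<dots> \<le> T * q" using assms by (intro mult_right_mono) auto
  finally show ?thesis by (simp add: net_class_def)
qed

definition net_collinear :: "nat \<Rightarrow> nat \<Rightarrow> nat \<Rightarrow> nat \<Rightarrow> bool" where
  "net_collinear q k s t \<longleftrightarrow> (\<exists>c<k. net_class q c s = net_class q c t)"

text \<open>By \<open>net_class_inj\<close> at most one summand is 1. For \<open>s = t\<close> the
  sum would be \<open>k\<close> instead; this excess is what produces the scalar matrix.\<close>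

lemma sum_net_class:
  assumes "s \<noteq> t"
  shows "(\<Sum>c<k. of_bool (net_class q c s = net_class q c t)) = (of_bool (net_collinear q k s t) :: 'a :: semiring_1)"
proof (cases "net_collinear q k s t")
  case True
  then obtain c where c: "c < k" "net_class q c s = net_class q c t"
    by (auto simp: net_collinear_def)
  have "(\<Sum>c'<k. of_bool (net_class q c' s = net_class q c' t)) = (\<Sum>c'<k. of_bool (c' = c) :: 'a)"
    using c net_class_inj[of q _ s t c] assms by (intro sum.cong) auto
  thus ?thesis using c True by (simp add: of_bool_def)
qed (auto simp: net_collinear_def)

text \<open>Let \<open>B\<close> be the sum of the common-line matrices of the first
  \<open>k\<close> classes and \<open>J\<close> the all-ones matrix. For \<open>a < 0\<close> and
  \<open>k = - a\<close> the adjacency matrix is \<open>B - k I = a I + B\<close>; for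
  \<open>a \<ge> 0\<close> and \<open>k = a + 1\<close> it is
  \<open>J - I - (B - k I) = a I + J - B\<close>.\<close>

definition net_adjacent :: "nat \<Rightarrow> int \<Rightarrow> nat \<Rightarrow> nat \<Rightarrow> bool" where
  "net_adjacent q a s t \<longleftrightarrow> s \<noteq> t \<and>
     (if a < 0 then net_collinear q (nat (- a)) s t else \<not> net_collinear q (nat (a + 1)) s t)"

text \<open>Class \<open>T\<close> stands for the single line containing all points, which turns the union of the
  classes \<open>c < a + 1\<close> into its complement.\<close>

definition net_coeff :: "nat \<Rightarrow> int \<Rightarrow> nat \<Rightarrow> 'a :: comm_ring_1" where
  "net_coeff T a c = (if c = T then of_bool (a \<ge> 0)
     else if a < 0 then of_bool (int c < - a) else - of_bool (int c < a + 1))"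

definition net_line :: "nat \<Rightarrow> nat \<Rightarrow> nat \<Rightarrow> nat \<Rightarrow> nat" where
  "net_line T q c s = (if c = T then 0 else net_class q c s)"

text \<open>Each pair \<open>(c, l)\<close> contributes a multiple of the indicator vector of a line
  times its transpose; summing over \<open>l\<close> gives the common-line matrix of class
  \<open>c\<close>.\<close>

lemma net_adjacent_low_rank:
  assumes a: "\<bar>a\<bar> < int T" and s: "s < q * q" and t: "t < q * q"
  shows "of_bool (net_adjacent q a s t) = (if s = t then of_int a else 0) +
    (\<Sum>(c, l)\<in>{..T} \<times> {..<T * q}. net_coeff T a c *
       of_bool (net_line T q c s = l) * (of_bool (net_line T q c t = l) :: 'a :: comm_ring_1))"
proof -
  have "T > 0" using a by auto
  have "q > 0" using s by (cases q) auto
  define \<sigma> :: "nat \<Rightarrow> 'a" where "\<sigma> k = (\<Sum>c<k. of_bool (net_class q c s = net_class q c t))" for k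
  have less: "net_line T q c s < T * q" if "c \<le> T" for c
    using that net_class_less[OF s, of c T] \<open>T > 0\<close> \<open>q > 0\<close> by (auto simp: net_line_def)
  have "(\<Sum>(c, l)\<in>{..T} \<times> {..<T * q}. net_coeff T a c *
       of_bool (net_line T q c s = l) * (of_bool (net_line T q c t = l) :: 'a)) =
    (\<Sum>c\<le>T. \<Sum>l<T * q. if l = net_line T q c s then net_coeff T a c *
       of_bool (net_line T q c t = net_line T q c s) else 0)"
    by (subst sum.cartesian_product[symmetric]) (auto intro!: sum.cong)
  also have "\<dots> = (\<Sum>c\<le>T. net_coeff T a c * of_bool (net_line T q c t = net_line T q c s))"
    by (intro sum.cong) (auto simp: less)
  also have "\<dots> = of_bool (a \<ge> 0) +
      (\<Sum>c<T. net_coeff T a c * of_bool (net_class q c s = net_class q c t))"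
    by (subst lessThan_Suc_atMost[symmetric], subst sum.lessThan_Suc, subst add.commute)
      (auto simp: net_coeff_def net_line_def intro!: arg_cong2[of _ _ _ _ "(+)"] sum.cong)
  also have "(\<Sum>c<T. net_coeff T a c * of_bool (net_class q c s = net_class q c t)) =
      (if a < 0 then \<sigma> (nat (- a)) else - \<sigma> (nat (a + 1)))"
  proof -
    \<comment> \<open>Since \<open>\<bar>a\<bar> < int T\<close>, both \<open>- a\<close> and
      \<open>a + 1\<close> are at most \<open>T\<close>, so the classes below \<open>T\<close>
      include all those counted by \<open>\<sigma>\<close>.\<close>
    have restrict: "(\<Sum>c<T. of_bool (c < k) * of_bool (net_class q c s = net_class q c t)) = \<sigma> k"
      if "k \<le> T" for k
      unfolding \<sigma>_def using that by (intro sum.mono_neutral_cong_right) auto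
    show ?thesis
    proof (cases "a < 0")
      case True
      have "(\<Sum>c<T. net_coeff T a c * of_bool (net_class q c s = net_class q c t)) =
        (\<Sum>c<T. of_bool (c < nat (- a)) * of_bool (net_class q c s = net_class q c t) :: 'a)"
        using True by (intro sum.cong) (auto simp: net_coeff_def)
      thus ?thesis using True a restrict[of "nat (- a)"] by simp
    next
      case False
      have "(\<Sum>c<T. net_coeff T a c * of_bool (net_class q c s = net_class q c t)) =
        (\<Sum>c<T. - (of_bool (c < nat (a + 1)) * of_bool (net_class q c s = net_class q c t)) :: 'a)"
        using False by (intro sum.cong) (auto simp: net_coeff_def)
      thus ?thesis using False a restrict[of "nat (a + 1)"] by (simp add: sum_negf)
    qed
  qed
  finally have sum_eq: "(\<Sum>(c, l)\<in>{..T} \<times> {..<T * q}. net_coeff T a c *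
       of_bool (net_line T q c s = l) * (of_bool (net_line T q c t = l) :: 'a)) =
      of_bool (a \<ge> 0) + (if a < 0 then \<sigma> (nat (- a)) else - \<sigma> (nat (a + 1)))" .
  show ?thesis
  proof (cases "s = t")
    \<comment> \<open>On the diagonal every class agrees, so \<open>\<sigma> k = k\<close>. The
      totals \<open>- a + a\<close> and \<open>1 - (a + 1) + a\<close> both vanish, matching the
      absence of loops.\<close>
    case True
    hence "\<sigma> k = of_nat k" for k by (simp add: \<sigma>_def)
    thus ?thesis unfolding sum_eq using True by (auto simp: net_adjacent_def)
  next
    case False
    hence "\<sigma> k = of_bool (net_collinear q k s t)" for k by (simp add: \<sigma>_def sum_net_class[OF False] del: sum_of_bool_eq)
    thus ?thesis unfolding sum_eq using False by (auto simp: net_adjacent_def)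
  qed
qed

text \<open>A vertex \<open>i < N * m\<close> stands for the point \<open>i div m\<close> paired
  with the row index \<open>i mod m\<close> of \<open>M\<close>. The vertices from
  \<open>N * m\<close> on are isolated and pad the graph to exactly \<open>n\<close>
  vertices.\<close>

definition net_graph :: "nat \<Rightarrow> nat \<Rightarrow> int mat \<Rightarrow> nat \<Rightarrow> nat \<Rightarrow> nat pair_pre_digraph" where
  "net_graph q m M N n = \<lparr>pverts = {..<n}, parcs = {(i, j). i < N * m \<and> j < N * m \<and>
     net_adjacent q (M $$ (i mod m, j mod m)) (i div m) (j div m)}\<rparr>"

text \<open>Symmetry comes from that of \<open>M\<close> and of collinearity. Loops cannot occur,
  whatever the diagonal of \<open>M\<close>, because adjacent vertices lie over distinct
  points.\<close>

lemma net_graph_simple: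
  assumes M: "M \<in> carrier_mat m m" "transpose_mat M = M" and n: "N * m \<le> n"
  shows "net_graph q m M N n \<in> simple_graphs n"
proof -
  have M_sym: "M $$ (i mod m, j mod m) = M $$ (j mod m, i mod m)" if "i < N * m" for i j
  proof -
    have "m > 0" using that by (cases m) auto
    thus ?thesis using M by (metis carrier_matD index_transpose_mat(1) mod_less_divisor)
  qed
  have sym: "net_adjacent q a s t = net_adjacent q a t s" for a s t
    by (auto simp: net_adjacent_def net_collinear_def)
  have "finite (parcs (net_graph q m M N n))"
    by (rule finite_subset[of _ "{..<N * m} \<times> {..<N * m}"]) (auto simp: net_graph_def)
  moreover have "(j, i) \<in> parcs (net_graph q m M N n)" if "(i, j) \<in> parcs (net_graph q m M N n)" for i j
    using that M_sym[of i j] sym by (simp add: net_graph_def)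
  moreover have "i < n" "j < n" "i \<noteq> j" if "(i, j) \<in> parcs (net_graph q m M N n)" for i j
    using that n by (auto simp: net_graph_def net_adjacent_def)
  moreover have "pverts (net_graph q m M N n) = {..<n}"
    by (simp add: net_graph_def)
  ultimately show ?thesis
    unfolding simple_graphs_def
    by (auto simp: symmetric_def sym_def
        intro!: pair_graph.intro pair_digraph.intro
        pair_pseudo_graph.intro pair_fin_digraph.intro pair_sym_digraph.intro
        pair_loopfree_digraph.intro pair_wf_digraph.intro pair_fin_digraph_axioms.intro
        pair_sym_digraph_axioms.intro pair_loopfree_digraph_axioms.intro)
qed

section \<open>Eigenvalue multiplicity of the block graph\<close>

lemma char_poly_four_block_diagonal:
  fixes A D :: "'a :: idom mat"
  assumes A: "A \<in> carrier_mat n n" and D: "D \<in> carrier_mat k k"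
  shows "char_poly (four_block_mat A (0\<^sub>m n k) (0\<^sub>m k n) D) = char_poly A * char_poly D"
proof -
  have "char_poly_matrix (four_block_mat A (0\<^sub>m n k) (0\<^sub>m k n) D) =
      four_block_mat (char_poly_matrix A) (0\<^sub>m n k) (0\<^sub>m k n) (char_poly_matrix D)"
    by (rule eq_matI) (use A D in \<open>auto simp: char_poly_matrix_def\<close>)
  thus ?thesis
    unfolding char_poly_def
    using det_four_block_mat_upper_right_zero[of "char_poly_matrix A" n _ k "0\<^sub>m k n" "char_poly_matrix D"] A D
    by simp
qed

lemma order_pow:
  fixes p :: "'a :: idom poly"
  assumes "p \<noteq> 0"
  shows "Polynomial.order a (p ^ n) = n * Polynomial.order a p"
  using assms by (induction n) (simp_all add: order_mult)

text \<open>The divisibility in \<open>char_poly_low_rank_update\<close> becomes an inequality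
  between orders at \<open>\<theta>\<close>. The rank bound counts \<open>Suc T\<close> classes,
  \<open>T * q\<close> lines in each, and \<open>m\<close> row indices of \<open>M\<close>.\<close>

lemma order_net_graph:
  fixes M :: "int mat"
  assumes M: "M \<in> carrier_mat m m" "transpose_mat M = M"
    and n: "N * m \<le> n" and q: "N \<le> q * q"
    and T: "\<And>i j. i < m \<Longrightarrow> j < m \<Longrightarrow> \<bar>M $$ (i, j)\<bar> < int T"
  shows "N * Polynomial.order \<theta> (char_poly (map_mat of_int M)) \<le>
    E_s n \<theta> + m * (Suc T * (T * q)) * Polynomial.order \<theta> (char_poly (map_mat of_int M))"
proof -
  define G where "G = net_graph q m M N n"
  define A where "A = adjacency_matrix (N * m) G"
  define k where "k = n - N * m"
  define E where "E = ({..T} \<times> {..<T * q}) \<times> {..<m}"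
  \<comment> \<open>The row index \<open>i'\<close> of \<open>M\<close> belongs to the summation
    index, so that \<open>v\<close> carries the coefficients for all columns of that row at once;
    this costs a factor \<open>m\<close> rather than \<open>m * m\<close>.\<close>
  define u :: "(nat \<times> nat) \<times> nat \<Rightarrow> nat \<Rightarrow> complex" where
    "u = (\<lambda>((c, l), i') i. of_bool (net_line T q c (i div m) = l) * of_bool (i' = i mod m))"
  define v :: "(nat \<times> nat) \<times> nat \<Rightarrow> nat \<Rightarrow> complex" where
    "v = (\<lambda>((c, l), i') j. net_coeff T (M $$ (i', j mod m)) c * of_bool (net_line T q c (j div m) = l))"
  let ?MC = "map_mat complex_of_int M"
  have MC: "?MC \<in> carrier_mat m m" using M by simp
  have A: "A \<in> carrier_mat (N * m) (N * m)" by (simp add: A_def adjacency_matrix_def)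
  have "char_poly ?MC ^ N dvd char_poly A * char_poly ?MC ^ card E"
  proof (rule char_poly_low_rank_update[OF A MC, where u = u and v = v])
    show "finite E" by (simp add: E_def)
    fix i j assume ij: "i < N * m" "j < N * m"
    hence m: "m > 0" by (cases m) auto
    have div: "i div m < q * q" "j div m < q * q"
      using ij q by (auto dest!: less_mult_imp_div_less)
    have "(\<Sum>e\<in>E. u e i * v e j) = (\<Sum>(c, l)\<in>{..T} \<times> {..<T * q}. \<Sum>i'<m. if i' = i mod m then
        net_coeff T (M $$ (i mod m, j mod m)) c * of_bool (net_line T q c (i div m) = l) *
          of_bool (net_line T q c (j div m) = l) else 0)"
      unfolding E_def sum.cartesian_product'
      by (intro sum.cong) (auto simp: u_def v_def intro!: sum.cong)
    also have "\<dots> = (\<Sum>(c, l)\<in>{..T} \<times> {..<T * q}.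
        net_coeff T (M $$ (i mod m, j mod m)) c * of_bool (net_line T q c (i div m) = l) *
          of_bool (net_line T q c (j div m) = l))"
      using m by (intro sum.cong) auto
    finally show "A $$ (i, j) = (if i div m = j div m then ?MC $$ (i mod m, j mod m) else 0) +
        (\<Sum>e\<in>E. u e i * v e j)"
      using ij m M net_adjacent_low_rank[OF T[of "i mod m" "j mod m"] div, where 'a = complex]
      by (simp add: A_def adjacency_matrix_def G_def net_graph_def)
  qed
  moreover have nz: "char_poly A \<noteq> 0" "char_poly ?MC \<noteq> 0"
    using degree_monic_char_poly[OF A] degree_monic_char_poly[OF MC] by auto
  ultimately have "Polynomial.order \<theta> (char_poly ?MC ^ N) \<le>
      Polynomial.order \<theta> (char_poly A * char_poly ?MC ^ card E)"
    by (intro dvd_imp_order_le) auto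
  hence 1: "N * Polynomial.order \<theta> (char_poly ?MC) \<le>
      Polynomial.order \<theta> (char_poly A) + card E * Polynomial.order \<theta> (char_poly ?MC)"
    using nz by (simp add: order_mult order_pow)
  \<comment> \<open>The isolated vertices form a zero block, whose characteristic polynomial is only
    an additional factor.\<close>
  have "adjacency_matrix n G = four_block_mat A (0\<^sub>m (N * m) k) (0\<^sub>m k (N * m)) (0\<^sub>m k k)"
    by (rule eq_matI) (use n in \<open>auto simp: A_def k_def adjacency_matrix_def G_def net_graph_def\<close>)
  hence "char_poly A dvd char_poly (adjacency_matrix n G)"
    by (simp add: char_poly_four_block_diagonal[OF A zero_carrier_mat])
  moreover have "char_poly (adjacency_matrix n G) \<noteq> 0"
    using degree_monic_char_poly[of "adjacency_matrix n G" n] by (auto simp: adjacency_matrix_def)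
  ultimately have "Polynomial.order \<theta> (char_poly A) \<le> eigenvalue_multiplicity \<theta> (adjacency_matrix n G)"
    unfolding eigenvalue_multiplicity_def by (intro dvd_imp_order_le)
  also have "\<dots> \<le> E_s n \<theta>"
    unfolding E_s_def using net_graph_simple[OF M n] finite_simple_graphs
    by (intro Max_ge) (auto simp: G_def)
  finally have "Polynomial.order \<theta> (char_poly A) \<le> E_s n \<theta>" .
  with 1 have "N * Polynomial.order \<theta> (char_poly ?MC) \<le>
      E_s n \<theta> + card E * Polynomial.order \<theta> (char_poly ?MC)"
    by linarith
  moreover have "card E = m * (Suc T * (T * q))" by (simp add: E_def card_cartesian_product)
  ultimately show ?thesis by simp
qed

section \<open>Choice of parameters and the asymptotic bound\<close>

theorem theorem6:
  fixes \<theta> :: complex and d :: nat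
  assumes "totally_real_algebraic_int \<theta>"
    and "algebraic_degree \<theta> = d" and "d > 1"
    and "representable \<theta>"
  shows "\<exists>f :: nat \<Rightarrow> real. f \<in> o(\<lambda>n. real n) \<and>
           (\<forall>n. real (E_s n \<theta>) \<ge> real n / real d - f n)"
proof -
  obtain m M h where M: "M \<in> carrier_mat m m" "transpose_mat M = (M :: int mat)"
    and h: "h \<in> ring_iso (generated_subring (ring_of_type_algebra :: complex ring) \<theta>)
                     (generated_subring (ring_mat TYPE(int) m ()) M)" "h \<theta> = M"
    using assms(4) unfolding representable_def by blast
  have m: "m > 0" by (rule ring_iso_imp_dim_pos[OF h(1) M(1)])
  define p where "p = minimal_polynomial \<theta>"
  have "algebraic \<theta>"
    using assms(1) by (auto simp: totally_real_algebraic_int_def intro: algebraic_int_imp_algebraic)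
  hence p: "is_minimal_polynomial p \<theta>"
    unfolding p_def minimal_polynomial_def by (rule theI'[OF ex1_minimal_polynomial])
  \<comment> \<open>An integer multiple of \<open>p\<close> is accessible to the ring isomorphism
    and, as \<open>c\<close> is nonzero, has the same complex roots.\<close>
  obtain r c where rc: "c \<noteq> 0" "map_poly of_int r = Polynomial.smult (rat_of_int c) p"
    using clear_denominators by blast
  have r: "poly (map_poly of_int r) x = of_int c * poly (map_poly of_rat p) x" for x :: complex
  proof -
    have "map_poly of_int r = (map_poly of_rat (map_poly of_int r) :: complex poly)"
      by (intro poly_eqI) (simp add: coeff_map_poly)
    thus ?thesis by (simp add: rc hom_distribs)
  qed
  define k where "k = Polynomial.order \<theta> (char_poly (map_mat of_int M))"
  have "m \<le> k * d"
    unfolding k_def assms(2)[symmetric] algebraic_degree_def p_def[symmetric]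
  proof (rule order_char_poly_conjugate_roots[OF M(1) p])
    fix \<mu> :: complex assume "eigenvalue (map_mat of_int M) \<mu>"
    thus "poly (map_poly of_rat p) \<mu> = 0"
      using ring_iso_annihilates_eigenvalues[OF M(1) h, of r \<mu>] p rc
      by (simp add: r is_minimal_polynomial_def)
  qed
  hence k: "1 / real d \<le> real k / real m"
    using m assms(3) by (simp add: field_simps flip: of_nat_mult)
  obtain T where T: "\<bar>M $$ (i, j)\<bar> < int T" if "i < m" "j < m" for i j
  proof
    define S where "S = (\<Sum>i<m. \<Sum>j<m. nat \<bar>M $$ (i, j)\<bar>)"
    fix i j assume ij: "i < m" "j < m"
    have "nat \<bar>M $$ (i, j)\<bar> \<le> (\<Sum>j<m. nat \<bar>M $$ (i, j)\<bar>)"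
      using ij by (intro member_le_sum) auto
    also have "\<dots> \<le> S"
      unfolding S_def using ij by (intro member_le_sum[where f = "\<lambda>i. \<Sum>j<m. nat \<bar>M $$ (i, j)\<bar>"]) auto
    finally show "\<bar>M $$ (i, j)\<bar> < int (Suc S)" by linarith
  qed
  define C where "C = real (k * (m * (Suc T * T)))"
  \<comment> \<open>The summand \<open>k\<close> pays for the rounding in \<open>n div m\<close>,
    the other one for the rank bound, in which \<open>q\<close> is at most
    \<open>sqrt n + 1\<close>.\<close>
  define f where "f n = real k + C * (sqrt (real n) + 1)" for n :: nat
  have "f \<in> o(\<lambda>n. real n)" unfolding f_def by real_asymp
  moreover have "real n / real d - f n \<le> real (E_s n \<theta>)" for n
  proof -
    \<comment> \<open>The smallest grid with at least \<open>n\<close> points; only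
      \<open>n div m\<close> of them are used.\<close>
    define q where "q = nat \<lceil>sqrt (real n)\<rceil>"
    have q: "real q \<le> sqrt (real n) + 1" "sqrt (real n) \<le> real q"
      by (simp_all add: q_def)
    have "real n \<le> real q * real q"
      using mult_mono[OF q(2,2)] by simp
    hence "n \<le> q * q" by (simp flip: of_nat_mult)
    hence "n div m \<le> q * q" using div_le_dividend[of n m] by linarith
    from order_net_graph[OF M _ this T, of n \<theta>]
    have "n div m * k \<le> E_s n \<theta> + m * (Suc T * (T * q)) * k"
      by (simp add: k_def)
    hence "real (n div m * k) \<le> real (E_s n \<theta> + m * (Suc T * (T * q)) * k)"
      by (simp only: of_nat_le_iff)
    hence 1: "real (n div m) * real k \<le> real (E_s n \<theta>) + C * real q"
      by (simp add: C_def algebra_simps)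
    have "real n / real d = real n * (1 / real d)" by simp
    also have "\<dots> \<le> real n * (real k / real m)" by (intro mult_left_mono k) simp
    also have "\<dots> = real n / real m * real k" by simp
    also have "\<dots> \<le> (real (n div m) + 1) * real k"
    proof (rule mult_right_mono)
      have "n \<le> (n div m + 1) * m" using m dividend_less_div_times[of m n] by simp
      hence "real n \<le> real ((n div m + 1) * m)" by (simp only: of_nat_le_iff)
      thus "real n / real m \<le> real (n div m) + 1" using m by (simp add: field_simps)
    qed simp
    also have "\<dots> \<le> real (E_s n \<theta>) + C * real q + real k"
      using 1 by (simp add: algebra_simps)
    also have "C * real q \<le> C * (sqrt (real n) + 1)"
      by (intro mult_left_mono q) (simp add: C_def)
    finally show ?thesis by (simp add: f_def)
  qed
  ultimately show ?thesis by blast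
qed

end
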